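(* The function $\beta$ is completely monotonic on $(0,\infty)$.
   Context: Nielsen's $\beta$-function is the function $\beta:(0,\infty)\to\mathbb{R}$ defined by $\beta(x)=\int_0^1 \frac{t^{x-1}}{1+t}\,dt=\int_0^\infty\frac{e^{-xt}}{1+e^{-t}}\,dt$ for $x>0$. A function $f:(0,\infty)\to\mathbb{R}$ is completely monotonic if $f$ has derivatives of all orders and $(-1)^k f^{(k)}(x)\ge 0$ for all $x\in(0,\infty)$ and all $k\in\mathbb{N}_0=\{0,1,2,\dots\}$. *)

theory Defs
  imports "HOL-Analysis.Analysis"
begin

text \<open>Only the values at \<open>x > 0\<close> are meaningful: for other \<open>x\<close> the integrand is not integrable.\<close>

definition nielsen_beta :: "real \<Rightarrow> real" where
  "nielsen_beta x = (LBINT t:{0<..<1}. t powr (x - 1) / (1 + t))"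

lemma nielsen_beta_integrable:
  assumes "x > 0"
  shows "set_integrable lborel {0<..<1} (\<lambda>t. t powr (x - 1) / (1 + t))"
    and "set_integrable lborel {0<..} (\<lambda>u. exp (- x * u) / (1 + exp (- u)))"
    and "nielsen_beta x = (LBINT u:{0<..}. exp (- x * u) / (1 + exp (- u)))"
proof -
  define f :: "real \<Rightarrow> real" where "f = (\<lambda>t. t powr (x - 1) / (1 + t))"
  define h :: "real \<Rightarrow> real" where "h = (\<lambda>u. exp (- x * u) / (1 + exp (- u)))"
  have meas_f: "(\<lambda>t. indicat_real {0<..<1} t *\<^sub>R f t) \<in> borel_measurable lborel"
    unfolding f_def by measurable
  have meas_h: "(\<lambda>u. indicat_real {0<..} u *\<^sub>R h u) \<in> borel_measurable lborel"
    unfolding h_def by measurable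
  have img: "(\<lambda>u. exp (- u)) ` {0<..} = {0<..<(1::real)}"
  proof (intro equalityI subsetI)
    fix t :: real assume "t \<in> {0<..<1}"
    then show "t \<in> (\<lambda>u. exp (- u)) ` {0<..}"
      by (intro image_eqI[of _ _ "- ln t"]) auto
  qed auto
  have pos: "1 + exp (- u) > (0::real)" for u
    by (simp add: add_pos_pos)
  have fg: "\<bar>- exp (- u)\<bar> * f (exp (- u)) = h u" for u
  proof -
    have "exp (- u) * exp (- u) powr (x - 1) = exp (- x * u)"
      by (simp add: powr_def exp_add[symmetric] algebra_simps)
    then show ?thesis
      by (simp add: f_def h_def)
  qed
  have "(\<lambda>u. exp (- x * u)) integrable_on {0..}"
    using integrable_on_exp_minus_to_infinity[OF assms] by simp
  then have "(\<lambda>u. exp (- x * u)) absolutely_integrable_on {0..}"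
    by (rule nonnegative_absolutely_integrable_1) auto
  then have "(\<lambda>u. exp (- x * u)) absolutely_integrable_on {0<..}"
    by (rule set_integrable_subset) auto
  moreover have "(\<lambda>u. indicat_real {0<..} u *\<^sub>R h u) \<in> borel_measurable lebesgue"
    by (intro measurable_completion meas_h)
  moreover have "norm (h u) \<le> norm (exp (- x * u))" for u
    using pos[of u] by (simp add: h_def divide_le_eq mult_le_cancel_left1)
  ultimately have h: "h absolutely_integrable_on {0<..}"
    by (intro set_integrable_bound[where g = h]) (auto simp: set_borel_measurable_def)
  have "((\<lambda>u. exp (- u)) has_field_derivative - exp (- u)) (at u within {0<..})" for u :: real
    by (auto intro!: derivative_eq_intros)
  then have f: "f absolutely_integrable_on {0<..<1}"
    and eq: "integral {0<..<1} f = integral {0<..} h"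
    using has_absolute_integral_change_of_variables_1'
        [of "{0<..}" "\<lambda>u. exp (- u)" "\<lambda>u. - exp (- u)" f "integral {0<..} h"] h
    unfolding img fg by (auto simp: inj_on_def)
  show 1: "set_integrable lborel {0<..<1} (\<lambda>t. t powr (x - 1) / (1 + t))"
    using f meas_f by (simp add: set_integrable_def integrable_completion f_def)
  show 2: "set_integrable lborel {0<..} (\<lambda>u. exp (- x * u) / (1 + exp (- u)))"
    using h meas_h by (simp add: set_integrable_def integrable_completion h_def)
  show "nielsen_beta x = (LBINT u:{0<..}. exp (- x * u) / (1 + exp (- u)))"
    using eq set_borel_integral_eq_integral(2)[OF 1] set_borel_integral_eq_integral(2)[OF 2]
    by (simp add: nielsen_beta_def f_def h_def)
qed

text \<open>
  A function on \<open>(0,\<infinity>)\<close> is represented by a total function on the reals; since \<open>(0,\<infinity>)\<close> is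
  open, the iterated derivatives at points \<open>x > 0\<close> depend only on the values of \<open>f\<close> on
  \<open>(0,\<infinity>)\<close>. As \<^const>\<open>deriv\<close> is unspecified where no derivative exists, differentiability
  of every iterated derivative is demanded explicitly.
\<close>

definition completely_monotonic :: "(real \<Rightarrow> real) \<Rightarrow> bool" where
  "completely_monotonic f \<longleftrightarrow>
     (\<forall>k. \<forall>x>0. (deriv ^^ k) f field_differentiable at x) \<and>
     (\<forall>k. \<forall>x>0. (-1) ^ k * (deriv ^^ k) f x \<ge> 0)"

end

theory Submission
  imports Defs
begin

text \<open>
  The integral \<open>\<integral> exp (- x * u) / (1 + exp (- u)) du\<close> over \<open>u > 0\<close> exhibits \<open>\<beta>\<close> as the Laplace
  transform of a positive measure on \<open>(0,\<infinity>)\<close>, namely the one with Lebesgue density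
  \<open>1 / (1 + exp (- u))\<close>. Complete monotonicity is then the easy half of Bernstein's theorem:
  differentiating \<open>k\<close> times under the integral sign brings down the factor \<open>(- u) ^ k\<close>, whose sign
  is \<open>(-1) ^ k\<close> throughout the support of the measure.

  Differentiation under the integral is justified by dominated convergence. To the right of
  \<open>x / 2\<close>, all difference quotients at \<open>x\<close> are dominated by a polynomial times \<open>exp (- (x / 2) * u)\<close>,
  and half of this exponential decay absorbs the polynomial, so that only the integrability of the
  exponentials themselves is used. This gives
  \<open>has_field_derivative_Laplace_moment\<close>, from which \<open>completely_monotonic_Laplace_transform\<close> follows.
\<close>

lemma power_le_exp_scaled:
  fixes u a :: real
  assumes "0 \<le> u" "0 < a"
  shows "u ^ k \<le> fact k / a ^ k * exp (a * u)"
proof -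
  have "(a * u) ^ k / fact k \<le> exp (a * u)"
    using sum_le_suminf[OF summable_exp_generic[of "a * u"], of "{k}"] assms
    by (simp add: exp_def divide_inverse mult.commute)
  then show ?thesis
    using assms by (simp add: field_simps power_mult_distrib)
qed

text \<open>Convexity of the exponential function bounds its chords by its slope at
  any point \<open>c\<close> to their right.\<close>

lemma abs_exp_diff_le:
  fixes a b c :: real
  assumes "a \<le> c" "b \<le> c"
  shows "\<bar>exp a - exp b\<bar> \<le> \<bar>a - b\<bar> * exp c"
proof -
  have chord: "exp s - exp t \<le> \<bar>s - t\<bar> * exp c" if "s \<le> c" for s t :: real
  proof -
    have "exp s - exp t = exp s * (1 - exp (t - s))"
      by (simp add: algebra_simps exp_diff)
    also have "\<dots> \<le> exp s * (s - t)"
    proof (rule mult_left_mono)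
      show "1 - exp (t - s) \<le> s - t"
        using exp_ge_add_one_self[of "t - s"] by linarith
    qed simp
    also have "\<dots> \<le> exp s * \<bar>s - t\<bar>"
      by (intro mult_left_mono) auto
    also have "\<dots> \<le> exp c * \<bar>s - t\<bar>"
      using that by (intro mult_right_mono) auto
    finally show ?thesis
      by (simp add: mult.commute)
  qed
  show ?thesis
    using chord[of a b] chord[of b a] assms by (simp add: abs_le_iff abs_minus_commute)
qed

context
  fixes M :: "real measure"
  assumes sets_M [measurable_cong]: "sets M = sets borel"
    and nonneg: "AE u in M. 0 \<le> u"
    and exp_integrable: "\<And>x. 0 < x \<Longrightarrow> integrable M (\<lambda>u. exp (- x * u))"
begin

text \<open>Half of the exponential decay absorbs the power.\<close>

lemma integrable_Laplace_moment:
  assumes "0 < x"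
  shows "integrable M (\<lambda>u. (- u) ^ k * exp (- x * u))"
proof (rule Bochner_Integration.integrable_bound)
  let ?C = "fact k / (x / 2) ^ k"
  show "integrable M (\<lambda>u. ?C * exp (- (x / 2) * u))"
    using assms by (intro integrable_mult_right exp_integrable) simp
  show "AE u in M. norm ((- u) ^ k * exp (- x * u)) \<le> norm (?C * exp (- (x / 2) * u))"
    using nonneg
  proof eventually_elim
    case (elim u)
    have "u ^ k * exp (- x * u) \<le> ?C * exp (x / 2 * u) * exp (- x * u)"
      using power_le_exp_scaled[OF elim, of "x / 2" k] assms by (intro mult_right_mono) auto
    also have "\<dots> = ?C * exp (- (x / 2) * u)"
      by (simp add: mult.assoc exp_add[symmetric] algebra_simps)
    finally show ?case
      using elim assms by (simp add: abs_mult power_abs)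
  qed
qed measurable

lemma has_field_derivative_Laplace_moment:
  assumes "0 < x"
  shows "((\<lambda>x. LINT u|M. (- u) ^ k * exp (- x * u)) has_field_derivative
           (LINT u|M. (- u) ^ Suc k * exp (- x * u))) (at x)"
proof -
  define q where
    "q y u = ((- u) ^ k * exp (- y * u) - (- u) ^ k * exp (- x * u)) / (y - x)" for y u :: real
  let ?g = "\<lambda>u. (- u) ^ Suc k * exp (- x * u)"
  \<comment> \<open>Dominated convergence concerns sequences, so the limit is tested along those tending to \<open>x\<close>.\<close>
  have "((\<lambda>y. LINT u|M. q y u) \<longlongrightarrow> (LINT u|M. ?g u)) (at x within {x / 2<..})"
    unfolding tendsto_at_iff_sequentially comp_def
  proof (intro allI impI)
    fix X :: "nat \<Rightarrow> real"
    assume X: "\<forall>i. X i \<in> {x / 2<..} - {x}" "X \<longlonglongrightarrow> x"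
    show "(\<lambda>n. LINT u|M. q (X n) u) \<longlonglongrightarrow> (LINT u|M. ?g u)"
    proof (rule integral_dominated_convergence)
      show "integrable M (\<lambda>u. \<bar>(- u) ^ Suc k * exp (- (x / 2) * u)\<bar>)"
        using assms by (intro integrable_abs integrable_Laplace_moment) simp
      show "AE u in M. (\<lambda>n. q (X n) u) \<longlonglongrightarrow> ?g u"
      proof (rule AE_I2)
        fix u
        have "((\<lambda>y. (- u) ^ k * exp (- y * u)) has_field_derivative ?g u) (at x)"
          by (auto intro!: derivative_eq_intros)
        then have "((\<lambda>y. q y u) \<longlongrightarrow> ?g u) (at x)"
          by (simp add: has_field_derivative_iff q_def)
        then show "(\<lambda>n. q (X n) u) \<longlonglongrightarrow> ?g u"
          using X unfolding tendsto_at_iff_sequentially comp_def by auto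
      qed
      show "AE u in M. norm (q (X n) u) \<le> \<bar>(- u) ^ Suc k * exp (- (x / 2) * u)\<bar>" for n
        using nonneg
      proof eventually_elim
        case (elim u)
        have X': "x / 2 < X n" "X n \<noteq> x"
          using X(1) by auto
        have le: "- y * u \<le> - (x / 2) * u" if "x / 2 \<le> y" for y
          using mult_right_mono[OF that elim] by simp
        have "\<bar>exp (- X n * u) - exp (- x * u)\<bar> \<le> \<bar>- X n * u - - x * u\<bar> * exp (- (x / 2) * u)"
          using X' assms by (intro abs_exp_diff_le le) auto
        also have "- X n * u - - x * u = (x - X n) * u"
          by (simp add: algebra_simps)
        finally have "\<bar>exp (- X n * u) - exp (- x * u)\<bar> / \<bar>X n - x\<bar> \<le> u * exp (- (x / 2) * u)"
          using X' elim by (simp add: abs_mult divide_le_eq abs_minus_commute mult_ac)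
        then have "u ^ k * (\<bar>exp (- X n * u) - exp (- x * u)\<bar> / \<bar>X n - x\<bar>)
            \<le> u ^ k * (u * exp (- (x / 2) * u))"
          using elim by (intro mult_left_mono) auto
        then show ?case
          using elim by (simp add: q_def right_diff_distrib[symmetric] abs_mult power_abs mult_ac)
      qed
    qed (simp_all add: q_def)
  qed
  then have "((\<lambda>y. LINT u|M. q y u) \<longlongrightarrow> (LINT u|M. ?g u)) (at x)"
    using assms by (subst (asm) at_within_open) auto
  moreover have "eventually (\<lambda>y. (LINT u|M. q y u) =
      ((LINT u|M. (- u) ^ k * exp (- y * u)) - (LINT u|M. (- u) ^ k * exp (- x * u))) / (y - x)) (at x)"
  proof -
    have "eventually (\<lambda>y. y \<in> {0<..}) (at x)"
      using assms by (intro eventually_at_in_open') auto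
    then show ?thesis
    proof eventually_elim
      case (elim y)
      then show ?case
        using integrable_Laplace_moment[of y k] integrable_Laplace_moment[OF assms, of k]
        by (simp add: q_def)
    qed
  qed
  ultimately show ?thesis
    unfolding has_field_derivative_iff by (rule Lim_transform_eventually)
qed

text \<open>
  The easy half of Bernstein's theorem, for a function \<open>f\<close> that need only agree with the transform
  on \<open>(0,\<infinity>)\<close>.
\<close>

lemma completely_monotonic_Laplace_transform:
  assumes f: "\<And>x. 0 < x \<Longrightarrow> f x = (LINT u|M. exp (- x * u))"
  shows "completely_monotonic f"
proof -
  define F where "F k x = (LINT u|M. (- u) ^ k * exp (- x * u))" for k and x :: real
  have transfer: "(g has_field_derivative F (Suc k) x) (at x)"
    if "\<And>y. 0 < y \<Longrightarrow> g y = F k y" "0 < x" for g k x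
  proof (rule has_field_derivative_transform_within_open)
    show "(F k has_field_derivative F (Suc k) x) (at x)"
      using has_field_derivative_Laplace_moment[OF \<open>0 < x\<close>, of k] by (simp add: F_def[abs_def])
    show "F k y = g y" if "y \<in> {0<..}" for y
      using that \<open>\<And>y. 0 < y \<Longrightarrow> g y = F k y\<close> by simp
  qed (use \<open>0 < x\<close> in auto)
  have iter: "(deriv ^^ k) f x = F k x" if "0 < x" for k x
    using that
  proof (induction k arbitrary: x)
    case 0
    then show ?case
      by (simp add: f F_def)
  next
    case (Suc k)
    then show ?case
      using DERIV_imp_deriv[OF transfer[of "(deriv ^^ k) f" k x]] by simp
  qed
  have "(-1) ^ k * F k x \<ge> 0" for k x
  proof -
    have "(-1) ^ k * F k x = (LINT u|M. u ^ k * exp (- x * u))"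
      unfolding F_def integral_mult_right_zero[symmetric]
      by (simp add: mult.assoc[symmetric] power_mult_distrib[symmetric])
    also have "\<dots> \<ge> 0"
      using nonneg by (intro integral_nonneg_AE) (auto elim!: eventually_mono)
    finally show ?thesis .
  qed
  then show ?thesis
    using iter transfer[OF iter]
    unfolding completely_monotonic_def field_differentiable_def by metis
qed

end

theorem proposition2p4:
  shows "completely_monotonic nielsen_beta"
proof -
  define w :: "real \<Rightarrow> real" where "w u = indicator {0<..} u / (1 + exp (- u))" for u
  let ?M = "density lborel (\<lambda>u. ennreal (w u))"
  have w_measurable [measurable]: "w \<in> borel_measurable borel"
    unfolding w_def[abs_def] by measurable
  have w_nonneg: "0 \<le> w u" for u
    by (simp add: w_def add_nonneg_nonneg)
  have w_exp: "w u * exp (- (x * u)) = indicator {0<..} u * exp (- (x * u)) / (1 + exp (- u))"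
    for x u
    by (simp add: w_def)
  show ?thesis
  proof (rule completely_monotonic_Laplace_transform[of ?M])
    show "AE u in ?M. 0 \<le> u"
      by (subst AE_density) (auto simp: w_def indicator_def)
    show "integrable ?M (\<lambda>u. exp (- x * u))" if "0 < x" for x
      using nielsen_beta_integrable(2)[OF that] w_nonneg
      by (subst integrable_density) (auto simp: w_exp set_integrable_def)
    show "nielsen_beta x = (LINT u|?M. exp (- x * u))" if "0 < x" for x
      using nielsen_beta_integrable(3)[OF that] w_nonneg
      by (subst integral_density) (auto simp: w_exp set_lebesgue_integral_def)
  qed simp
qed

end
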